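(* Let $X$ and $Y$ be finite $T_0$ topological spaces. If $F:X\multimap Y$ is an upper semicontinuous (respectively, lower semicontinuous) multivalued map such that $F(x)$ contains a maximum (respectively, minimum) for every $x\in X$, then there exists a continuous selector $f$ for $F$ with $F_*=f_*$. Furthermore, if $X=Y$, then $\Lambda(F_* )=\Lambda(f)$, and if $g$ is another continuous selector for $F$, then $\Lambda(g)=\Lambda(F_* )$.
   Context: A finite $T_0$ topological space is identified with a finite poset: $x\le y$ iff $U_x\subseteq U_y$, where $U_x$ is the intersection of all open sets containing $x$ (so the open sets are the lower sets); continuous maps are exactly the order-preserving maps. $H_*$ is singular homology with integer coefficients. A multivalued map $F:X\multimap Y$ assigns to each $x\in X$ a subset $F(x)\subseteq Y$. It is upper semicontinuous (usc) if for all $x_1\le x_2$ in $X$ and all $y_1\in F(x_1)$ there is $y_2\in F(x_2)$ with $y_1\le y_2$; it is lower semicontinuous (lsc) if for all $x_1\ge x_2$ in $X$ and all $y_1\in F(x_1)$ there is $y_2\in F(x_2)$ with $y_1\ge y_2$. "$F(x)$ contains a maximum (minimum)" means that the subposet $F(x)$ has a greatest (least) element. A continuous selector for $F$ is a continuous map $f:X\to Y$ with $f(x)\in F(x)$ for every $x\in X$. The graph is $\Gamma(F)=\{(x,y)\in X\times Y : y\in F(x)\}$ with the order induced by the product order, with projections $p:\Gamma(F)\to X$ and $q:\Gamma(F)\to Y$. Whenever $p$ induces isomorphisms in all homology groups (as it does under the hypotheses here), $F_*:=q_*\circ p_*^{-1}:H_*(X)\to H_*(Y)$. For a degree-preserving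 endomorphism $\varphi$ of $H_*(X)$, $\Lambda(\varphi)=\sum_{i\ge0}(-1)^i\,\mathrm{tr}(\varphi_i)$, the trace being taken on the torsion-free part of $H_i(X)$; for a continuous $f:X\to X$, $\Lambda(f)=\Lambda(f_* )$. *)

theory Defs
  imports "HOL-Homology.Homology" "HOL-Analysis.Analysis"
begin

definition minimal_nbhd :: "'a topology \<Rightarrow> 'a \<Rightarrow> 'a set" where
  "minimal_nbhd X x = \<Inter>{U. openin X U \<and> x \<in> U}"

definition specialization_le :: "'a topology \<Rightarrow> 'a \<Rightarrow> 'a \<Rightarrow> bool" where
  "specialization_le X x y \<longleftrightarrow> minimal_nbhd X x \<subseteq> minimal_nbhd X y"

definition lower_set_topology :: "'a set \<Rightarrow> ('a \<Rightarrow> 'a \<Rightarrow> bool) \<Rightarrow> 'a topology" where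
  "lower_set_topology A R = topology (\<lambda>U. U \<subseteq> A \<and> (\<forall>y\<in>U. \<forall>x\<in>A. R x y \<longrightarrow> x \<in> U))"

lemma openin_lower_set_topology:
  "openin (lower_set_topology A R) U \<longleftrightarrow> U \<subseteq> A \<and> (\<forall>y\<in>U. \<forall>x\<in>A. R x y \<longrightarrow> x \<in> U)"
proof -
  have "istopology (\<lambda>U. U \<subseteq> A \<and> (\<forall>y\<in>U. \<forall>x\<in>A. R x y \<longrightarrow> x \<in> U))"
    unfolding istopology_def by blast
  then show ?thesis
    by (simp add: lower_set_topology_def topology_inverse')
qed

lemma openin_minimal_nbhd:
  assumes "finite (topspace X)" "x \<in> topspace X"
  shows "openin X (minimal_nbhd X x)"
proof -
  have "{U. openin X U \<and> x \<in> U} \<subseteq> Pow (topspace X)"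
    by (auto dest: openin_subset)
  then have "finite {U. openin X U \<and> x \<in> U}"
    using assms(1) by (meson finite_Pow_iff finite_subset)
  then show ?thesis
    unfolding minimal_nbhd_def using assms(2) openin_topspace by (intro openin_Inter) auto
qed

lemma specialization_le_iff:
  assumes "finite (topspace X)" "y \<in> topspace X"
  shows "specialization_le X x y \<longleftrightarrow> x \<in> minimal_nbhd X y"
  using openin_minimal_nbhd[OF assms] unfolding specialization_le_def minimal_nbhd_def by blast

text \<open>A finite space carries exactly the lower-set topology of its own order.\<close>

lemma lower_set_topology_specialization_le:
  assumes "finite (topspace X)"
  shows "lower_set_topology (topspace X) (specialization_le X) = X"
proof (rule topology_eq[THEN iffD2], intro allI iffI)
  fix U assume "openin X U"
  then show "openin (lower_set_topology (topspace X) (specialization_le X)) U"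
    unfolding openin_lower_set_topology
    using openin_subset[of X U] specialization_le_iff[OF assms] unfolding minimal_nbhd_def by blast
next
  fix U assume U: "openin (lower_set_topology (topspace X) (specialization_le X)) U"
  show "openin X U"
  proof (subst openin_subopen, intro ballI)
    fix x assume "x \<in> U"
    with U have x: "x \<in> topspace X" by (auto simp: openin_lower_set_topology)
    have "minimal_nbhd X x \<subseteq> U"
      using U \<open>x \<in> U\<close> specialization_le_iff[OF assms x] openin_subset[OF openin_minimal_nbhd[OF assms x]]
      by (auto simp: openin_lower_set_topology)
    then show "\<exists>T. openin X T \<and> x \<in> T \<and> T \<subseteq> U"
      using openin_minimal_nbhd[OF assms x] by (auto simp: minimal_nbhd_def)
  qed
qed

definition multivalued_map :: "'a topology \<Rightarrow> 'b topology \<Rightarrow> ('a \<Rightarrow> 'b set) \<Rightarrow> bool" where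
  "multivalued_map X Y F \<longleftrightarrow> (\<forall>x\<in>topspace X. F x \<subseteq> topspace Y)"

definition usc :: "'a topology \<Rightarrow> 'b topology \<Rightarrow> ('a \<Rightarrow> 'b set) \<Rightarrow> bool" where
  "usc X Y F \<longleftrightarrow> (\<forall>x1\<in>topspace X. \<forall>x2\<in>topspace X. specialization_le X x1 x2 \<longrightarrow>
     (\<forall>y1\<in>F x1. \<exists>y2\<in>F x2. specialization_le Y y1 y2))"

definition lsc :: "'a topology \<Rightarrow> 'b topology \<Rightarrow> ('a \<Rightarrow> 'b set) \<Rightarrow> bool" where
  "lsc X Y F \<longleftrightarrow> (\<forall>x1\<in>topspace X. \<forall>x2\<in>topspace X. specialization_le X x2 x1 \<longrightarrow>
     (\<forall>y1\<in>F x1. \<exists>y2\<in>F x2. specialization_le Y y2 y1))"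

definition contains_maximum :: "'b topology \<Rightarrow> 'b set \<Rightarrow> bool" where
  "contains_maximum Y S \<longleftrightarrow> (\<exists>m\<in>S. \<forall>y\<in>S. specialization_le Y y m)"

definition contains_minimum :: "'b topology \<Rightarrow> 'b set \<Rightarrow> bool" where
  "contains_minimum Y S \<longleftrightarrow> (\<exists>m\<in>S. \<forall>y\<in>S. specialization_le Y m y)"

definition continuous_selector ::
    "'a topology \<Rightarrow> 'b topology \<Rightarrow> ('a \<Rightarrow> 'b set) \<Rightarrow> ('a \<Rightarrow> 'b) \<Rightarrow> bool" where
  "continuous_selector X Y F f \<longleftrightarrow> continuous_map X Y f \<and> (\<forall>x\<in>topspace X. f x \<in> F x)"

definition graph_space :: "'a topology \<Rightarrow> 'b topology \<Rightarrow> ('a \<Rightarrow> 'b set) \<Rightarrow> ('a \<times> 'b) topology" where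
  "graph_space X Y F = lower_set_topology
     {(x, y). x \<in> topspace X \<and> y \<in> topspace Y \<and> y \<in> F x}
     (\<lambda>(x, y) (x', y'). specialization_le X x x' \<and> specialization_le Y y y')"

lemma graph_space_eq_subtopology:
  assumes fin: "finite (topspace X)" "finite (topspace Y)"
  shows "graph_space X Y F = subtopology (prod_topology X Y) {(x, y). y \<in> F x}"
proof (rule topology_eq[THEN iffD2], intro allI iffI)
  fix U assume U: "openin (graph_space X Y F) U"
  show "openin (subtopology (prod_topology X Y) {(x, y). y \<in> F x}) U"
  proof (subst openin_subopen, intro ballI)
    fix z assume z: "z \<in> U"
    obtain x y where xy: "z = (x, y)" by fastforce
    have x: "x \<in> topspace X" and y: "y \<in> topspace Y" and yF: "y \<in> F x"
      using U z xy by (auto simp: graph_space_def openin_lower_set_topology)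
    let ?T = "(minimal_nbhd X x \<times> minimal_nbhd Y y) \<inter> {(x, y). y \<in> F x}"
    note ox = openin_minimal_nbhd[OF fin(1) x] and oy = openin_minimal_nbhd[OF fin(2) y]
    have "openin (subtopology (prod_topology X Y) {(x, y). y \<in> F x}) ?T"
      using ox oy by (intro openin_subtopology_Int) (simp add: openin_prod_Times_iff)
    moreover have "z \<in> ?T" using xy yF by (auto simp: minimal_nbhd_def)
    moreover have "w \<in> U" if w: "w \<in> ?T" for w
    proof -
      let ?R = "\<lambda>(x, y) (x', y'). specialization_le X x x' \<and> specialization_le Y y y'"
      have "w \<in> {(x, y). x \<in> topspace X \<and> y \<in> topspace Y \<and> y \<in> F x}"
        using w openin_subset[OF ox] openin_subset[OF oy] by blast
      moreover have "?R w z"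
        using w xy specialization_le_iff[OF fin(1) x] specialization_le_iff[OF fin(2) y]
        by (cases w) simp
      ultimately show ?thesis
        using U z unfolding graph_space_def openin_lower_set_topology by blast
    qed
    ultimately show "\<exists>T. openin (subtopology (prod_topology X Y) {(x, y). y \<in> F x}) T \<and> z \<in> T \<and> T \<subseteq> U"
      by (intro exI[of _ ?T]) blast
  qed
next
  fix U assume "openin (subtopology (prod_topology X Y) {(x, y). y \<in> F x}) U"
  then obtain T where T: "openin (prod_topology X Y) T" "U = T \<inter> {(x, y). y \<in> F x}"
    by (auto simp: openin_subtopology)
  have TT: "(x', y') \<in> T" if xy: "(x, y) \<in> T" and le: "specialization_le X x' x" "specialization_le Y y' y" for x y x' y'
  proof -
    obtain A B where AB: "openin X A" "openin Y B" "x \<in> A" "y \<in> B" "A \<times> B \<subseteq> T"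
      using T(1)[unfolded openin_prod_topology_alt, rule_format, OF xy] by blast
    then have "x \<in> topspace X" "y \<in> topspace Y" by (auto dest: openin_subset)
    then have "x' \<in> minimal_nbhd X x" "y' \<in> minimal_nbhd Y y"
      using le specialization_le_iff fin by metis+
    then have "x' \<in> A" "y' \<in> B"
      using AB(1-4) unfolding minimal_nbhd_def by blast+
    then show ?thesis using AB by auto
  qed
  show "openin (graph_space X Y F) U"
    unfolding graph_space_def openin_lower_set_topology
  proof (intro conjI ballI impI)
    show "U \<subseteq> {(x, y). x \<in> topspace X \<and> y \<in> topspace Y \<and> y \<in> F x}"
      using T(2) openin_subset[OF T(1)] by auto
  next
    fix z w
    assume "z \<in> U" "w \<in> {(x, y). x \<in> topspace X \<and> y \<in> topspace Y \<and> y \<in> F x}"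
      "(\<lambda>(x, y) (x', y'). specialization_le X x x' \<and> specialization_le Y y y') w z"
    then show "w \<in> U"
      using T(2) TT[of "fst z" "snd z" "fst w" "snd w"] by (simp add: case_prod_beta)
  qed
qed

text \<open>The map \<open>q\<^sub>* \<circ> p\<^sub>*\<inverse>\<close> in degree \<open>i\<close>; only meaningful on the carrier of the homology of
  \<open>X\<close>, and when \<open>p\<^sub>*\<close> is an isomorphism.\<close>

definition multivalued_hom ::
    "int \<Rightarrow> 'a topology \<Rightarrow> 'b topology \<Rightarrow> ('a \<Rightarrow> 'b set) \<Rightarrow> 'a chain set \<Rightarrow> 'b chain set" where
  "multivalued_hom i X Y F =
     hom_induced i (graph_space X Y F) {} Y {} snd \<circ>
     inv_into (carrier (homology_group i (graph_space X Y F)))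
       (hom_induced i (graph_space X Y F) {} X {} fst)"

definition torsion_subgroup :: "('a, 'm) monoid_scheme \<Rightarrow> 'a set" where
  "torsion_subgroup G = {x \<in> carrier G. \<exists>n::nat. n > 0 \<and> x [^]\<^bsub>G\<^esub> n = \<one>\<^bsub>G\<^esub>}"

definition is_coordinates :: "('a, 'm) monoid_scheme \<Rightarrow> 'a set \<Rightarrow> 'a \<Rightarrow> ('a \<Rightarrow> int) \<Rightarrow> bool" where
  "is_coordinates G B x a \<longleftrightarrow>
     a \<in> extensional B \<and> x = finprod G (\<lambda>b. b [^]\<^bsub>G\<^esub> a b) B"

definition finite_basis :: "('a, 'm) monoid_scheme \<Rightarrow> 'a set \<Rightarrow> bool" where
  "finite_basis G B \<longleftrightarrow>
     finite B \<and> B \<subseteq> carrier G \<and> (\<forall>x\<in>carrier G. \<exists>!a. is_coordinates G B x a)"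

text \<open>The trace of an endomorphism of a free abelian group of finite rank does not depend on the
  basis, so the choice below is immaterial.  The value is 0 if there is no finite basis.\<close>

definition free_trace :: "('a, 'm) monoid_scheme \<Rightarrow> ('a \<Rightarrow> 'a) \<Rightarrow> int" where
  "free_trace G \<phi> =
     (if \<exists>B. finite_basis G B
      then let B = (SOME B. finite_basis G B)
           in \<Sum>b\<in>B. (THE a. is_coordinates G B (\<phi> b) a) b
      else 0)"

text \<open>For an endomorphism \<open>\<phi>\<close> of \<open>G\<close> with torsion subgroup \<open>T\<close>, the induced endomorphism of
  \<open>G Mod T\<close> sends a coset \<open>C\<close> to the coset of \<open>\<phi> x\<close>, for any \<open>x \<in> C\<close>; the union
  below is over equal cosets.\<close>

definition torsion_free_trace :: "('a, 'm) monoid_scheme \<Rightarrow> ('a \<Rightarrow> 'a) \<Rightarrow> int" where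
  "torsion_free_trace G \<phi> =
     (let T = torsion_subgroup G
      in free_trace (G Mod T) (\<lambda>C. \<Union>x\<in>C. T #>\<^bsub>G\<^esub> \<phi> x))"

text \<open>\<open>Sum_any\<close> is the sum over all indices of a finitely supported family; for a finite space
  the homology vanishes in high degrees.\<close>

definition lefschetz_number :: "'a topology \<Rightarrow> (int \<Rightarrow> 'a chain set \<Rightarrow> 'a chain set) \<Rightarrow> int" where
  "lefschetz_number X \<phi> =
     Sum_any (\<lambda>i::nat. (- 1) ^ i * torsion_free_trace (homology_group (int i) X) (\<phi> (int i)))"

definition lefschetz_number_map :: "'a topology \<Rightarrow> ('a \<Rightarrow> 'a) \<Rightarrow> int" where
  "lefschetz_number_map X f = lefschetz_number X (\<lambda>i. hom_induced i X {} X {} f)"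

end

theory Submission
  imports Defs
begin

text \<open>The order of a finite space controls its homotopy theory: if \<open>f \<le> g\<close> pointwise, then \<open>f\<close> and
  \<open>g\<close> are homotopic, by the homotopy that stays at \<open>f\<close> for all times \<open>t < 1\<close> and jumps to \<open>g\<close> at
  \<open>t = 1\<close>.  The jump is continuous because open sets are lower sets, so a point \<open>(1, x)\<close> that is
  mapped into an open set has a neighbourhood that is mapped there as well.

  In the upper semicontinuous case let \<open>f x\<close> be the maximum of \<open>F x\<close>.  Semicontinuity says exactly that
  \<open>f\<close> is monotone, hence continuous.  The section \<open>s x = (x, f x)\<close> of the projection
  \<open>p : \<Gamma>(F) \<rightarrow> X\<close> then satisfies \<open>p \<circ> s = id\<close> and \<open>s \<circ> p \<ge> id\<close>, so \<open>s\<close> is a homotopy inverse of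
  \<open>p\<close>.  Therefore \<open>p\<^sub>*\<close> is an isomorphism with inverse \<open>s\<^sub>*\<close>, and
  \<open>F\<^sub>* = q\<^sub>* \<circ> s\<^sub>* = (q \<circ> s)\<^sub>* = f\<^sub>*\<close>.  Any other continuous selector \<open>g\<close> satisfies \<open>g \<le> f\<close>,
  so it is homotopic to \<open>f\<close> and has the same Lefschetz number.  In the lower semicontinuous case all
  inequalities are reversed; since homotopy is symmetric, both cases are carried along together.\<close>

lemma specialization_le_iff_open:
  "specialization_le X x y \<longleftrightarrow> (\<forall>U. openin X U \<and> y \<in> U \<longrightarrow> x \<in> U)"
  unfolding specialization_le_def minimal_nbhd_def by blast

lemma continuous_map_if_monotone:
  assumes fin: "finite (topspace X)"
    and f: "f \<in> topspace X \<rightarrow> topspace Y"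
    and mono: "\<And>x x'. x \<in> topspace X \<Longrightarrow> x' \<in> topspace X \<Longrightarrow> specialization_le X x x'
                 \<Longrightarrow> specialization_le Y (f x) (f x')"
  shows "continuous_map X Y f"
  unfolding continuous_map_def
proof (intro conjI allI impI)
  fix V assume V: "openin Y V"
  show "openin X {x \<in> topspace X. f x \<in> V}"
  proof (subst openin_subopen, intro ballI)
    fix x assume x: "x \<in> {x \<in> topspace X. f x \<in> V}"
    then have U: "openin X (minimal_nbhd X x)"
      using openin_minimal_nbhd[OF fin] by blast
    have "f z \<in> V" if z: "z \<in> minimal_nbhd X x" for z
    proof -
      have "z \<in> topspace X" "specialization_le X z x"
        using z x openin_subset[OF U] specialization_le_iff[OF fin] by auto
      then have "specialization_le Y (f z) (f x)"
        using mono x by blast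
      then show ?thesis
        using V x unfolding specialization_le_iff_open by blast
    qed
    then show "\<exists>T. openin X T \<and> x \<in> T \<and> T \<subseteq> {x \<in> topspace X. f x \<in> V}"
      using U openin_subset[OF U] by (intro exI[of _ "minimal_nbhd X x"]) (auto simp: minimal_nbhd_def)
  qed
qed (use f in auto)

section \<open>Pointwise comparable maps are homotopic\<close>

text \<open>The homotopy equals \<open>f\<close> on the relatively open set \<open>[0, 1)\<close> of times and \<open>g\<close> at time \<open>1\<close>.
  The preimage of an open set is the union of two open boxes, because every point that \<open>g\<close> maps into
  the open set is also mapped there by the smaller map \<open>f\<close>.\<close>

lemma homotopic_if_le:
  assumes f: "continuous_map X Y f" and g: "continuous_map X Y g"
    and le: "\<And>x. x \<in> topspace X \<Longrightarrow> specialization_le Y (f x) (g x)"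
  shows "homotopic_with (\<lambda>h. True) X Y f g"
proof -
  let ?I = "top_of_set {0..1::real}"
  define k where "k = (\<lambda>(t::real, x). if t < 1 then f x else g x)"
  have "continuous_map (prod_topology ?I X) Y k"
    unfolding continuous_map_def
  proof (intro conjI allI impI)
    show "k \<in> topspace (prod_topology ?I X) \<rightarrow> topspace Y"
      using continuous_map_funspace[OF f] continuous_map_funspace[OF g] by (auto simp: k_def)
  next
    fix V assume V: "openin Y V"
    let ?f = "{x \<in> topspace X. f x \<in> V}" and ?g = "{x \<in> topspace X. g x \<in> V}"
    have op: "openin X ?f" "openin X ?g"
      using f g V by (auto intro: openin_continuous_map_preimage)
    have "?g \<subseteq> ?f"
      using le V unfolding specialization_le_iff_open by blast
    then have "{z \<in> topspace (prod_topology ?I X). k z \<in> V} = ({0..1} \<times> ?g) \<union> ({0..<1} \<times> ?f)"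
      by (auto simp: k_def split: if_splits)
    moreover have "openin ?I {0..<1}"
    proof -
      have "{0..<1} = {0..1} \<inter> {..<1::real}" by auto
      then show ?thesis using openin_open_Int open_lessThan by metis
    qed
    ultimately show "openin (prod_topology ?I X) {z \<in> topspace (prod_topology ?I X). k z \<in> V}"
      using op by (auto intro!: openin_Un simp: openin_prod_Times_iff)
  qed
  then show ?thesis
    unfolding homotopic_with_def by (intro exI[of _ k]) (auto simp: k_def)
qed

lemma homotopic_if_comparable:
  assumes "continuous_map X Y f" "continuous_map X Y g"
    and "(\<forall>x\<in>topspace X. specialization_le Y (f x) (g x)) \<or>
         (\<forall>x\<in>topspace X. specialization_le Y (g x) (f x))"
  shows "homotopic_with (\<lambda>h. True) X Y f g"
  using assms(3)
proof
  assume "\<forall>x\<in>topspace X. specialization_le Y (f x) (g x)"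
  then show ?thesis using assms(1,2) by (intro homotopic_if_le) auto
next
  assume "\<forall>x\<in>topspace X. specialization_le Y (g x) (f x)"
  then have "homotopic_with (\<lambda>h. True) X Y g f" using assms(1,2) by (intro homotopic_if_le) auto
  then show ?thesis by (rule homotopic_with_symD)
qed

section \<open>Extremal selectors and the projections of the graph\<close>

text \<open>The disjunction lets choices of maxima and choices of minima be treated at once.\<close>

definition extremal_selector ::
    "'a topology \<Rightarrow> 'b topology \<Rightarrow> ('a \<Rightarrow> 'b set) \<Rightarrow> ('a \<Rightarrow> 'b) \<Rightarrow> bool" where
  "extremal_selector X Y F f \<longleftrightarrow> continuous_selector X Y F f \<and>
     ((\<forall>x\<in>topspace X. \<forall>y\<in>F x. specialization_le Y y (f x)) \<or>
      (\<forall>x\<in>topspace X. \<forall>y\<in>F x. specialization_le Y (f x) y))"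

text \<open>If \<open>x \<le> x'\<close>, upper semicontinuity provides an element of \<open>F x'\<close> above \<open>max (F x)\<close>, and
  \<open>max (F x')\<close> lies above that element; hence choosing maxima is monotone.  Dually for minima.\<close>

lemma extremal_selector_exists:
  assumes fin: "finite (topspace X)" and F: "multivalued_map X Y F"
    and sc: "usc X Y F \<and> (\<forall>x\<in>topspace X. contains_maximum Y (F x)) \<or>
             lsc X Y F \<and> (\<forall>x\<in>topspace X. contains_minimum Y (F x))"
  shows "\<exists>f. extremal_selector X Y F f"
proof -
  have trans: "specialization_le Y a c" if "specialization_le Y a b" "specialization_le Y b c" for a b c
    using that unfolding specialization_le_def by blast
  have sel: "continuous_selector X Y F f"
    if f: "\<And>x. x \<in> topspace X \<Longrightarrow> f x \<in> F x"
      and mono: "\<And>x x'. x \<in> topspace X \<Longrightarrow> x' \<in> topspace X \<Longrightarrow> specialization_le X x x'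
                  \<Longrightarrow> specialization_le Y (f x) (f x')" for f
    unfolding continuous_selector_def
  proof
    have "f \<in> topspace X \<rightarrow> topspace Y"
      using f F by (auto simp: multivalued_map_def)
    then show "continuous_map X Y f"
      using mono by (rule continuous_map_if_monotone[OF fin])
  qed (use f in blast)
  from sc show ?thesis
  proof
    assume usc: "usc X Y F \<and> (\<forall>x\<in>topspace X. contains_maximum Y (F x))"
    then obtain f where f: "\<And>x. x \<in> topspace X \<Longrightarrow> f x \<in> F x"
      and max: "\<And>x y. x \<in> topspace X \<Longrightarrow> y \<in> F x \<Longrightarrow> specialization_le Y y (f x)"
      unfolding contains_maximum_def by metis
    have "specialization_le Y (f x) (f x')"
      if x: "x \<in> topspace X" and x': "x' \<in> topspace X" and le: "specialization_le X x x'" for x x'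
    proof -
      obtain y where "y \<in> F x'" "specialization_le Y (f x) y"
        using usc f[OF x] x x' le unfolding usc_def by blast
      then show ?thesis
        using max[OF x'] trans by blast
    qed
    then show ?thesis
      using sel f max unfolding extremal_selector_def by blast
  next
    assume lsc: "lsc X Y F \<and> (\<forall>x\<in>topspace X. contains_minimum Y (F x))"
    then obtain f where f: "\<And>x. x \<in> topspace X \<Longrightarrow> f x \<in> F x"
      and min: "\<And>x y. x \<in> topspace X \<Longrightarrow> y \<in> F x \<Longrightarrow> specialization_le Y (f x) y"
      unfolding contains_minimum_def by metis
    have "specialization_le Y (f x) (f x')"
      if x: "x \<in> topspace X" and x': "x' \<in> topspace X" and le: "specialization_le X x x'" for x x'
    proof -
      obtain y where "y \<in> F x" "specialization_le Y y (f x')"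
        using lsc f[OF x'] x x' le unfolding lsc_def by blast
      then show ?thesis
        using min[OF x] trans by blast
    qed
    then show ?thesis
      using sel f min unfolding extremal_selector_def by blast
  qed
qed

text \<open>The value of any other selector at \<open>x\<close> is an element of \<open>F x\<close>, hence comparable with \<open>f x\<close>,
  and on the same side for every \<open>x\<close>.\<close>

lemma hom_induced_selector_eq:
  assumes f: "extremal_selector X Y F f" and g: "continuous_selector X Y F g"
  shows "hom_induced i X {} Y {} g = hom_induced i X {} Y {} f"
  using f g unfolding extremal_selector_def continuous_selector_def
  by (intro homology_homotopy_empty homotopic_if_comparable) auto

context
  fixes X :: "'a topology" and Y :: "'b topology" and F :: "'a \<Rightarrow> 'b set"
  assumes fin: "finite (topspace X)" "finite (topspace Y)"
begin

lemma continuous_map_graph_fst: "continuous_map (graph_space X Y F) X fst"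
  unfolding graph_space_eq_subtopology[OF fin]
  by (intro continuous_map_from_subtopology continuous_map_fst)

lemma continuous_map_graph_snd: "continuous_map (graph_space X Y F) Y snd"
  unfolding graph_space_eq_subtopology[OF fin]
  by (intro continuous_map_from_subtopology continuous_map_snd)

lemma continuous_map_graph_section:
  assumes "continuous_selector X Y F f"
  shows "continuous_map X (graph_space X Y F) (\<lambda>x. (x, f x))"
  using assms unfolding graph_space_eq_subtopology[OF fin] continuous_selector_def
  by (auto simp: continuous_map_in_subtopology intro!: continuous_map_pairedI)

text \<open>The composite \<open>s \<circ> p\<close> moves the point \<open>(x, y)\<close> of the graph to \<open>(x, f x)\<close>, which lies in the same
  fibre and is comparable with \<open>(x, y)\<close>, always in the same direction.\<close>

lemma graph_section_homotopic_id:
  assumes f: "extremal_selector X Y F f"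
  shows "homotopic_with (\<lambda>h. True) (graph_space X Y F) (graph_space X Y F)
           ((\<lambda>x. (x, f x)) \<circ> fst) id"
proof (rule homotopic_if_comparable)
  let ?G = "graph_space X Y F"
  have sel: "continuous_selector X Y F f"
    using f by (simp add: extremal_selector_def)
  show "continuous_map ?G ?G ((\<lambda>x. (x, f x)) \<circ> fst)"
    using continuous_map_graph_fst continuous_map_graph_section[OF sel] by (rule continuous_map_compose)
  have top: "topspace ?G = {(x, y). x \<in> topspace X \<and> y \<in> topspace Y \<and> y \<in> F x}"
    using graph_space_eq_subtopology[OF fin, of F] by auto
  have le: "specialization_le ?G (x, y) (x, y')"
    if "(x, y) \<in> topspace ?G" "(x, y') \<in> topspace ?G" "specialization_le Y y y'" for x y y'
    unfolding specialization_le_iff_open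
  proof (intro allI impI)
    fix U assume U: "openin ?G U \<and> (x, y') \<in> U"
    then have lower: "\<And>z a b. z \<in> U \<Longrightarrow> (a, b) \<in> topspace ?G \<Longrightarrow>
        specialization_le X a (fst z) \<Longrightarrow> specialization_le Y b (snd z) \<Longrightarrow> (a, b) \<in> U"
      unfolding graph_space_def openin_lower_set_topology top[unfolded graph_space_def]
      by (simp add: case_prod_beta)
    show "(x, y) \<in> U"
      using lower[of "(x, y')" x y] U that by (simp add: specialization_le_def)
  qed
  have s: "(x, f x) \<in> topspace ?G" if "x \<in> topspace X" for x
    using continuous_map_funspace[OF continuous_map_graph_section[OF sel]] that by auto
  have in_fibre: "fst z \<in> topspace X" "snd z \<in> F (fst z)" if "z \<in> topspace ?G" for z
    using that unfolding top by auto
  have up: "specialization_le ?G z (fst z, f (fst z))"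
    if z: "z \<in> topspace ?G" and "specialization_le Y (snd z) (f (fst z))" for z
    using le[of "fst z" "snd z" "f (fst z)"] s in_fibre[OF z] that by simp
  have down: "specialization_le ?G (fst z, f (fst z)) z"
    if z: "z \<in> topspace ?G" and "specialization_le Y (f (fst z)) (snd z)" for z
    using le[of "fst z" "f (fst z)" "snd z"] s in_fibre[OF z] that by simp
  show "(\<forall>z\<in>topspace ?G. specialization_le ?G (((\<lambda>x. (x, f x)) \<circ> fst) z) (id z)) \<or>
        (\<forall>z\<in>topspace ?G. specialization_le ?G (id z) (((\<lambda>x. (x, f x)) \<circ> fst) z))"
    using f[unfolded extremal_selector_def, THEN conjunct2]
  proof
    assume "\<forall>x\<in>topspace X. \<forall>y\<in>F x. specialization_le Y y (f x)"
    then show ?thesis using up in_fibre by simp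
  next
    assume "\<forall>x\<in>topspace X. \<forall>y\<in>F x. specialization_le Y (f x) y"
    then show ?thesis using down in_fibre by simp
  qed
qed simp

lemma hom_induced_graph_fst_iso:
  assumes f: "extremal_selector X Y F f"
  shows "hom_induced i (graph_space X Y F) {} X {} fst
           \<in> iso (homology_group i (graph_space X Y F)) (homology_group i X)"
proof (rule homotopy_equivalence_homology_group_isomorphism)
  have sel: "continuous_selector X Y F f"
    using f by (simp add: extremal_selector_def)
  show "continuous_map X (graph_space X Y F) (\<lambda>x. (x, f x))"
    using sel by (rule continuous_map_graph_section)
  show "homotopic_with (\<lambda>h. True) X X (fst \<circ> (\<lambda>x. (x, f x))) id"
    by (simp add: comp_def id_def)
qed (fact continuous_map_graph_fst graph_section_homotopic_id[OF f])+

text \<open>Since \<open>p\<^sub>*\<close> is injective and \<open>p\<^sub>* (s\<^sub>* c) = c\<close>, the inverse of \<open>p\<^sub>*\<close> takes the value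
  \<open>s\<^sub>* c\<close> at \<open>c\<close>, and \<open>q \<circ> s = f\<close>.\<close>

lemma multivalued_hom_eq_hom_induced:
  assumes f: "extremal_selector X Y F f" and c: "c \<in> carrier (homology_group i X)"
  shows "multivalued_hom i X Y F c = hom_induced i X {} Y {} f c"
proof -
  let ?G = "graph_space X Y F" and ?s = "\<lambda>x. (x, f x)"
  let ?p = "hom_induced i ?G {} X {} fst" and ?sc = "hom_induced i X {} ?G {} ?s c"
  have s: "continuous_map X ?G ?s"
    using f continuous_map_graph_section by (simp add: extremal_selector_def)
  have "?p ?sc = hom_induced i X {} X {} (fst \<circ> ?s) c"
    using hom_induced_compose_empty[OF s continuous_map_graph_fst] by simp
  also have "\<dots> = c"
    using hom_induced_id[OF c] by (simp add: comp_def id_def)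
  finally have "?p ?sc = c" .
  moreover have "inj_on ?p (carrier (homology_group i ?G))"
    using hom_induced_graph_fst_iso[OF f] by (simp add: iso_iff)
  moreover have "?sc \<in> carrier (homology_group i ?G)"
    using hom_induced_empty_hom c by (rule hom_in_carrier)
  ultimately have "inv_into (carrier (homology_group i ?G)) ?p c = ?sc"
    by (intro inv_into_f_eq)
  then have "multivalued_hom i X Y F c = hom_induced i X {} Y {} (snd \<circ> ?s) c"
    using hom_induced_compose_empty[OF s continuous_map_graph_snd]
    by (simp add: multivalued_hom_def)
  then show ?thesis
    by (simp add: comp_def)
qed

end

section \<open>Traces depend only on the values on the group\<close>

text \<open>The homomorphism \<open>F\<^sub>*\<close> is built from a choice of inverse that is arbitrary outside the homology
  group, so \<open>F\<^sub>*\<close> and \<open>f\<^sub>*\<close> agree as maps on the group but not as total functions.\<close>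

lemma free_trace_cong:
  assumes "\<And>x. x \<in> carrier G \<Longrightarrow> \<phi> x = \<psi> x"
  shows "free_trace G \<phi> = free_trace G \<psi>"
proof (cases "\<exists>B. finite_basis G B")
  case True
  define B where "B = (SOME B. finite_basis G B)"
  have "finite_basis G B"
    unfolding B_def using True by (rule someI_ex)
  then have "B \<subseteq> carrier G"
    by (simp add: finite_basis_def)
  then have "(\<Sum>b\<in>B. (THE a. is_coordinates G B (\<phi> b) a) b) =
             (\<Sum>b\<in>B. (THE a. is_coordinates G B (\<psi> b) a) b)"
    using assms by (intro sum.cong) auto
  then show ?thesis
    by (simp add: free_trace_def B_def Let_def)
qed (simp add: free_trace_def)

lemma torsion_free_trace_cong:
  fixes G (structure)
  assumes "group G" and eq: "\<And>x. x \<in> carrier G \<Longrightarrow> \<phi> x = \<psi> x"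
  shows "torsion_free_trace G \<phi> = torsion_free_trace G \<psi>"
proof -
  interpret group G by fact
  let ?T = "torsion_subgroup G"
  have T: "?T \<subseteq> carrier G"
    by (auto simp: torsion_subgroup_def)
  have "(\<Union>x\<in>C. ?T #> \<phi> x) = (\<Union>x\<in>C. ?T #> \<psi> x)" if "C \<in> carrier (G Mod ?T)" for C
  proof -
    have "C \<subseteq> carrier G"
      using that T r_coset_subset_G by (auto simp: FactGroup_def RCOSETS_def)
    then show ?thesis using eq by (intro SUP_cong) auto
  qed
  then show ?thesis
    unfolding torsion_free_trace_def Let_def by (rule free_trace_cong)
qed

lemma lefschetz_number_cong:
  assumes "\<And>i c. c \<in> carrier (homology_group i X) \<Longrightarrow> \<phi> i c = \<psi> i c"
  shows "lefschetz_number X \<phi> = lefschetz_number X \<psi>"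
proof -
  have "torsion_free_trace (homology_group i X) (\<phi> i) = torsion_free_trace (homology_group i X) (\<psi> i)" for i
    using assms by (intro torsion_free_trace_cong) auto
  then show ?thesis
    by (simp add: lefschetz_number_def)
qed

theorem proposition3p6:
  fixes X :: "'a topology" and Y :: "'b topology"
  assumes "finite (topspace X)" and "t0_space X"
    and "finite (topspace Y)" and "t0_space Y"
  shows
    "(\<forall>F. multivalued_map X Y F \<and>
          (usc X Y F \<and> (\<forall>x\<in>topspace X. contains_maximum Y (F x)) \<or>
           lsc X Y F \<and> (\<forall>x\<in>topspace X. contains_minimum Y (F x))) \<longrightarrow>
        (\<forall>i. hom_induced i (graph_space X Y F) {} X {} fst
               \<in> iso (homology_group i (graph_space X Y F)) (homology_group i X)) \<and>
        (\<exists>f. continuous_selector X Y F f \<and>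
             (\<forall>i. \<forall>c\<in>carrier (homology_group i X).
                multivalued_hom i X Y F c = hom_induced i X {} Y {} f c))) \<and>
     (\<forall>F. multivalued_map X X F \<and>
          (usc X X F \<and> (\<forall>x\<in>topspace X. contains_maximum X (F x)) \<or>
           lsc X X F \<and> (\<forall>x\<in>topspace X. contains_minimum X (F x))) \<longrightarrow>
        (\<exists>f. continuous_selector X X F f \<and>
             (\<forall>i. \<forall>c\<in>carrier (homology_group i X).
                multivalued_hom i X X F c = hom_induced i X {} X {} f c) \<and>
             lefschetz_number X (\<lambda>i. multivalued_hom i X X F) = lefschetz_number_map X f \<and>
             (\<forall>g. continuous_selector X X F g \<longrightarrow>
                lefschetz_number_map X g = lefschetz_number X (\<lambda>i. multivalued_hom i X X F))))"
proof (intro conjI allI impI)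
  fix F
  assume F: "multivalued_map X Y F \<and>
      (usc X Y F \<and> (\<forall>x\<in>topspace X. contains_maximum Y (F x)) \<or>
       lsc X Y F \<and> (\<forall>x\<in>topspace X. contains_minimum Y (F x)))"
  then obtain f where f: "extremal_selector X Y F f"
    using extremal_selector_exists[OF assms(1)] by blast
  show "hom_induced i (graph_space X Y F) {} X {} fst
          \<in> iso (homology_group i (graph_space X Y F)) (homology_group i X)" for i
    using hom_induced_graph_fst_iso[OF assms(1,3) f] .
  show "\<exists>f. continuous_selector X Y F f \<and>
          (\<forall>i. \<forall>c\<in>carrier (homology_group i X).
             multivalued_hom i X Y F c = hom_induced i X {} Y {} f c)"
    using f multivalued_hom_eq_hom_induced[OF assms(1,3) f] by (auto simp: extremal_selector_def)
next
  fix F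
  assume F: "multivalued_map X X F \<and>
      (usc X X F \<and> (\<forall>x\<in>topspace X. contains_maximum X (F x)) \<or>
       lsc X X F \<and> (\<forall>x\<in>topspace X. contains_minimum X (F x)))"
  then obtain f where f: "extremal_selector X X F f"
    using extremal_selector_exists[OF assms(1)] by blast
  have hom: "multivalued_hom i X X F c = hom_induced i X {} X {} f c"
    if "c \<in> carrier (homology_group i X)" for i c
    using multivalued_hom_eq_hom_induced[OF assms(1,1) f that] .
  have lef: "lefschetz_number X (\<lambda>i. multivalued_hom i X X F) = lefschetz_number_map X f"
    unfolding lefschetz_number_map_def using hom by (rule lefschetz_number_cong)
  moreover have "lefschetz_number_map X g = lefschetz_number X (\<lambda>i. multivalued_hom i X X F)"
    if "continuous_selector X X F g" for g
    unfolding lef lefschetz_number_map_def hom_induced_selector_eq[OF f that] ..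
  ultimately show "\<exists>f. continuous_selector X X F f \<and>
      (\<forall>i. \<forall>c\<in>carrier (homology_group i X).
         multivalued_hom i X X F c = hom_induced i X {} X {} f c) \<and>
      lefschetz_number X (\<lambda>i. multivalued_hom i X X F) = lefschetz_number_map X f \<and>
      (\<forall>g. continuous_selector X X F g \<longrightarrow>
         lefschetz_number_map X g = lefschetz_number X (\<lambda>i. multivalued_hom i X X F))"
    using f hom unfolding extremal_selector_def by blast
qed

end
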